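(* Let $0<k<n$ be integers and let $\sigma\in S_n$. For each $i\in[n]$ let $\lambda_i$ be the number of cycles of $\sigma$ of length $i$. For each $m\ge 0$ let $H^*_m$ be the coefficient of $t^m$ in $H^*(\Delta_{k,n};S_n)[t]$. Then $$H^*_m(\sigma)=\sum_{h=0}^{k-1}\left(\sum_{I\in\mathcal I_h}(-1)^{|I|}\binom{\lambda_1}{I_1}\cdots\binom{\lambda_{k-1}}{I_{k-1}}\right)\bigl|\Phi_{k-h}(\sigma,m(k-h)-h)\bigr|.$$
   Context: Notation: $[n]=\{1,\dots,n\}$. The hypersimplex is $\Delta_{k,n}=\{x\in\mathbb R^n: 0\le x_i\le 1 \text{ for all } i,\ x_1+\dots+x_n=k\}$; $S_n$ acts on $\mathbb R^n$ by permuting coordinates and leaves $\Delta_{k,n}$ invariant. Equivariant $H^*$-series: for $d\ge 1$ let $\chi_d$ be the character of the permutation representation of $S_n$ on the lattice points $d\Delta_{k,n}\cap\mathbb Z^n$, so $\chi_d(\sigma)=|\{x\in d\Delta_{k,n}\cap\mathbb Z^n:\sigma(x)=x\}|$; let $\chi_0$ be the trivial character. Let $\rho(\sigma)$ be the $n\times n$ permutation matrix of $\sigma$. Then $H^*(\Delta_{k,n};S_n)[t]=\sum_{m\ge0}H^*_mt^m$ is the power series with coefficients in the representation ring of $S_n$ (over $\mathbb C$, virtual representations being identified with their characters) defined by $$\sum_{d\ge0}\chi_d(\sigma)t^d=\frac{\sum_{m\ge0}H^*_m(\sigma)t^m}{\det(I_n-t\rho(\sigma))}\quad\text{for all }\sigma\in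 S_n.$$ If $\sigma\in S_n$ has cycle type $(s_1,\dots,s_r)$ (the multiset of lengths of its disjoint cycles, including fixed points), then for integers $\ell\ge1$ and $m\ge0$, $$\Phi_\ell(\sigma,m)=\Bigl\{f:[r]\to\{0,1,\dots,\ell-1\}:\sum_{i=1}^r f(i)s_i=m\Bigr\},$$ and $\Phi_\ell(\sigma,m)=\emptyset$ for $m<0$. For $h\ge0$, $$\mathcal I_h=\Bigl\{I=(I_1,\dots,I_{k-1})\in\mathbb Z_{\ge0}^{k-1}:\sum_{i=1}^{k-1}i\,I_i=h\Bigr\},\qquad |I|=I_1+\dots+I_{k-1}.$$ *)

theory Defs
  imports
    "Jordan_Normal_Form.Determinant"
    "HOL-Combinatorics.Orbits"
    "HOL-Library.FuncSet"
    "HOL-Computational_Algebra.Formal_Power_Series"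
begin

text \<open>
  The symmetric group \<open>S\<^sub>n\<close> is the set of all \<open>\<sigma>\<close> with \<open>\<sigma> permutes {..<n}\<close>; coordinates of
  vectors are numbered \<open>0, \<dots>, n - 1\<close>, as in the matrix library.
\<close>

section \<open>Hypersimplices and their lattice points\<close>

definition hypersimplex :: "nat \<Rightarrow> nat \<Rightarrow> real vec set" where
  "hypersimplex k n =
     {x \<in> carrier_vec n. (\<forall>i<n. 0 \<le> x $ i \<and> x $ i \<le> 1) \<and> (\<Sum>i<n. x $ i) = real k}"

definition dilate_lattice_points :: "nat \<Rightarrow> nat \<Rightarrow> nat \<Rightarrow> real vec set" where
  "dilate_lattice_points k n d =
     ((\<lambda>x. real d \<cdot>\<^sub>v x) ` hypersimplex k n) \<inter> {x \<in> carrier_vec n. \<forall>i<n. x $ i \<in> \<int>}"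

text \<open>Left action: \<open>\<sigma>\<close> sends the basis vector \<open>e\<^sub>j\<close> to \<open>e\<^bsub>\<sigma> j\<^esub>\<close>.\<close>

definition permute_coords :: "(nat \<Rightarrow> nat) \<Rightarrow> 'a vec \<Rightarrow> 'a vec" where
  "permute_coords \<sigma> x = vec (dim_vec x) (\<lambda>i. x $ (inv_into UNIV \<sigma> i))"

definition perm_mat :: "nat \<Rightarrow> (nat \<Rightarrow> nat) \<Rightarrow> 'a :: zero_neq_one mat" where
  "perm_mat n \<sigma> = mat n n (\<lambda>(i, j). if i = \<sigma> j then 1 else 0)"

definition perm_character :: "nat \<Rightarrow> nat \<Rightarrow> nat \<Rightarrow> (nat \<Rightarrow> nat) \<Rightarrow> nat" where
  "perm_character k n d \<sigma> =
     (if d = 0 then 1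
      else card {x \<in> dilate_lattice_points k n d. permute_coords \<sigma> x = x})"

section \<open>The representation ring of the symmetric group\<close>

definition sym_representation :: "nat \<Rightarrow> nat \<Rightarrow> ((nat \<Rightarrow> nat) \<Rightarrow> complex mat) \<Rightarrow> bool" where
  "sym_representation n N R \<longleftrightarrow>
     (\<forall>\<sigma>. \<sigma> permutes {..<n} \<longrightarrow> R \<sigma> \<in> carrier_mat N N) \<and>
     R id = 1\<^sub>m N \<and>
     (\<forall>\<sigma> \<tau>. \<sigma> permutes {..<n} \<longrightarrow> \<tau> permutes {..<n} \<longrightarrow> R (\<sigma> \<circ> \<tau>) = R \<sigma> * R \<tau>)"

definition character :: "((nat \<Rightarrow> nat) \<Rightarrow> complex mat) \<Rightarrow> (nat \<Rightarrow> nat) \<Rightarrow> complex" where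
  "character R \<sigma> = (\<Sum>i<dim_row (R \<sigma>). R \<sigma> $$ (i, i))"

text \<open>
  An element \<open>[R] - [R']\<close> of the representation ring, identified with its character. Values
  outside \<open>S\<^sub>n\<close> are irrelevant.
\<close>

definition virtual_character :: "nat \<Rightarrow> ((nat \<Rightarrow> nat) \<Rightarrow> complex) \<Rightarrow> bool" where
  "virtual_character n \<phi> \<longleftrightarrow>
     (\<exists>N R N' R'. sym_representation n N R \<and> sym_representation n N' R' \<and>
        (\<forall>\<sigma>. \<sigma> permutes {..<n} \<longrightarrow> \<phi> \<sigma> = character R \<sigma> - character R' \<sigma>))"

section \<open>The equivariant \<open>H\<^sup>*\<close>-series\<close>

text \<open>
  \<open>H m\<close> is the coefficient of \<open>t\<^sup>m\<close>. The denominator \<open>det (I - t \<rho>(\<sigma>))\<close> is a power series with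
  constant term \<open>1\<close>, so the division below is multiplication by its inverse; in particular the
  equation determines every \<open>H m\<close> on \<open>S\<^sub>n\<close>.
\<close>

definition equivariant_Hstar_series ::
  "nat \<Rightarrow> nat \<Rightarrow> (nat \<Rightarrow> (nat \<Rightarrow> nat) \<Rightarrow> complex) \<Rightarrow> bool" where
  "equivariant_Hstar_series k n H \<longleftrightarrow>
     (\<forall>m. virtual_character n (H m)) \<and>
     (\<forall>\<sigma>. \<sigma> permutes {..<n} \<longrightarrow>
        Abs_fps (\<lambda>d. of_nat (perm_character k n d \<sigma>)) =
        Abs_fps (\<lambda>m. H m \<sigma>) / det (1\<^sub>m n - fps_X \<cdot>\<^sub>m (perm_mat n \<sigma> :: complex fps mat)))"

section \<open>Cycles and the combinatorial data\<close>

text \<open>The orbit of a fixed point \<open>i\<close> is \<open>{i}\<close>, so fixed points count as cycles of length one.\<close>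

definition cycle_type :: "nat \<Rightarrow> (nat \<Rightarrow> nat) \<Rightarrow> nat multiset" where
  "cycle_type n \<sigma> = image_mset card (mset_set (orbit \<sigma> ` {..<n}))"

definition num_cycles :: "nat \<Rightarrow> (nat \<Rightarrow> nat) \<Rightarrow> nat \<Rightarrow> nat" where
  "num_cycles n \<sigma> i = count (cycle_type n \<sigma>) i"

text \<open>
  The cycle lengths \<open>s\<^sub>1, \<dots>, s\<^sub>r\<close> are listed in increasing order; only the cardinality of
  \<open>Phi\<close> is used, and it does not depend on the order.
\<close>

definition Phi :: "nat \<Rightarrow> nat \<Rightarrow> (nat \<Rightarrow> nat) \<Rightarrow> int \<Rightarrow> (nat \<Rightarrow> nat) set" where
  "Phi n l \<sigma> m =
     (let s = sorted_list_of_multiset (cycle_type n \<sigma>); r = length s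
      in {f \<in> {1..r} \<rightarrow>\<^sub>E {0..<l}. int (\<Sum>i=1..r. f i * s ! (i - 1)) = m})"

definition index_tuples :: "nat \<Rightarrow> nat \<Rightarrow> (nat \<Rightarrow> nat) set" where
  "index_tuples k h = {I \<in> {1..k - 1} \<rightarrow>\<^sub>E UNIV. (\<Sum>i=1..k - 1. i * I i) = h}"

end

theory Submission
  imports Defs "HOL-Combinatorics.Cycles"
begin

text \<open>
  Let \<open>\<sigma>\<close> have cycles \<open>C\<close> of lengths \<open>|C|\<close>. Then \<open>det (I - t \<rho>(\<sigma>)) = D(t)\<close> with
  \<open>D(t) = \<Prod>\<^sub>C (1 - t\<^bsup>|C|\<^esup>) = \<Sum>\<^sub>j e\<^sub>j t\<^sup>j\<close>; write \<open>1 / D(z) = \<Sum>\<^sub>j p\<^sub>j z\<^sup>j\<close>, with \<open>p\<^sub>j = 0\<close> for \<open>j < 0\<close>.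

  For \<open>l \<ge> 1\<close> let \<open>b(l, z)\<close> be the number of functions \<open>f\<close> from the cycles to \<open>{0, \<dots>, l - 1}\<close>
  with \<open>\<Sum>\<^sub>C f(C) |C| = z\<close>. This one quantity counts both sides of the theorem: by
  definition \<open>b(l, z) = |\<Phi>\<^sub>l(\<sigma>, z)|\<close>, and since a vector is fixed by \<open>\<sigma>\<close> iff it is constant on
  the cycles, \<open>\<chi>\<^sub>d(\<sigma>) = b(d + 1, k d)\<close> (lemmas \<open>card_Phi\<close> and
  \<open>perm_character_eq_card_box_solutions\<close>). The generating function of \<open>b(l, \<cdot>)\<close> is a product of
  truncated geometric series, hence equals \<open>D(z\<^sup>l) / D(z)\<close>, which gives
  \<open>b(l, z) = \<Sum>\<^sub>j e\<^sub>j p(z - l j)\<close> (lemma \<open>card_box_solutions_expand\<close>).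

  Apply this twice. First, \<open>\<chi>\<^sub>d(\<sigma>) = \<Sum>\<^sub>h e\<^sub>h p(k d - (d + 1) h)\<close>, and only \<open>h < k\<close> matter, as
  \<open>(d + 1) h \<le> k d\<close> forces \<open>h < k\<close>. Multiplying by \<open>D(t)\<close>, the coefficient of \<open>t\<^sup>m\<close> becomes
  \<open>\<Sum>\<^sub>h e\<^sub>h \<Sum>\<^sub>j e\<^sub>j p((k - h) (m - j) - h)\<close>. Second, the inner sum is exactly the expansion of
  \<open>b(k - h, m (k - h) - h)\<close> (theorem \<open>denominator_times_box_series\<close>). It remains to read off
  \<open>e\<^sub>h\<close> for \<open>h < k\<close> by the binomial theorem from \<open>D = \<Prod>\<^sub>i (1 - t\<^sup>i)\<^bsup>\<lambda>\<^sub>i\<^esup>\<close>, in which the factors with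
  \<open>i \<ge> k\<close> are \<open>1\<close> modulo \<open>t\<^sup>k\<close> (lemma \<open>denominator_nth\<close>).
\<close>

section \<open>The determinant of \<open>I - c P\<close> for a permutation matrix \<open>P\<close>\<close>

lemma sign_cycle_of_list:
  assumes "distinct cs"
  shows "sign (cycle_of_list cs) = (-1) ^ (length cs - 1)"
  using assms
proof (induction cs rule: cycle_of_list.induct)
  case (1 i j cs)
  then show ?case
    unfolding cycle_of_list.simps
    by (subst sign_compose) (simp_all add: permutation_swap_id permutation_of_cycle sign_swap_id)
qed simp_all

lemma sign_perm_restrict_orbit:
  assumes p: "permutation p"
  shows "sign (perm_restrict p (orbit p a)) = (-1) ^ (card (orbit p a) - 1)"
proof -
  let ?cs = "support p a"
  have set_cs: "set ?cs = orbit p a"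
    unfolding support_set[OF p] orbit_altdef_permutation[OF p] by auto
  have dist: "distinct ?cs"
    by (rule cycle_of_permutation[OF p])
  have "perm_restrict p (orbit p a) x = cycle_of_list ?cs x" for x
  proof (cases "x \<in> orbit p a")
    case True
    then show ?thesis
      using cycle_restrict[OF p, of x a] set_cs by (simp add: perm_restrict_def)
  next
    case False
    then show ?thesis
      using id_outside_supp[of x ?cs] set_cs by (simp add: perm_restrict_def)
  qed
  then have "perm_restrict p (orbit p a) = cycle_of_list ?cs"
    by blast
  moreover have "length ?cs = card (orbit p a)"
    using distinct_card[OF dist] set_cs by simp
  ultimately show ?thesis
    using sign_cycle_of_list[OF dist] by simp
qed

lemma pairwise_disjnt_orbits:
  assumes "permutation p"
  shows "pairwise disjnt (range (orbit p))"
  unfolding pairwise_def disjnt_def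
  by (metis assms cyclic_on_orbit' disjoint_iff orbit_cyclic_eq3 rangeE)

lemma image_orbit:
  assumes p: "p permutes A" and A: "finite A"
  shows "p ` orbit p x = orbit p x"
proof
  show "p ` orbit p x \<subseteq> orbit p x"
    by (auto intro: orbit.step)
  then show "orbit p x \<subseteq> p ` orbit p x"
    using endo_inj_surj[of "orbit p x" p] finite_cyclic_on[OF cyclic_on_orbit[OF p A]]
      inj_on_subset[OF permutes_inj[OF p]] by blast
qed

lemma perm_restrict_permutes:
  assumes p: "p permutes A" and "S \<subseteq> A" "p ` S = S"
  shows "perm_restrict p S permutes S"
proof (rule bij_imp_permutes)
  have "inj_on p S"
    using permutes_inj[OF p] by (rule inj_on_subset) simp
  then have "bij_betw p S S"
    using \<open>p ` S = S\<close> by (simp add: bij_betw_def)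
  then show "bij_betw (perm_restrict p S) S S"
    by (subst bij_betw_cong[of S _ p]) (simp_all add: perm_restrict_def)
qed (simp add: perm_restrict_def)

text \<open>
  A union of orbits is restricted to one orbit at a time: on disjoint invariant sets the
  restrictions compose, and the sign is multiplicative.
\<close>

lemma sign_perm_restrict_Union_orbits:
  assumes p: "p permutes A" and A: "finite A" and "\<C> \<subseteq> orbit p ` A"
  shows "sign (perm_restrict p (\<Union>\<C>)) = (\<Prod>C\<in>\<C>. (-1) ^ (card C - 1))"
proof -
  have perm: "permutation p"
    using p A permutation_permutes by blast
  have cyc: "cyclic_on p C" if "C \<in> orbit p ` A" for C
    using that cyclic_on_orbit'[OF perm] by auto
  have inv_C: "p ` C = C" if "C \<in> orbit p ` A" for C
    using that image_orbit[OF p A] by auto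
  have sub: "C \<subseteq> A" if "C \<in> orbit p ` A" for C
    using that permutes_orbit_subset[OF p] by auto
  have perm_r: "permutation (perm_restrict p (\<Union>\<D>))" if "\<D> \<subseteq> orbit p ` A" for \<D>
  proof -
    have "p ` \<Union>\<D> = (\<Union>C\<in>\<D>. p ` C)"
      by (rule image_Union)
    also have "\<dots> = (\<Union>C\<in>\<D>. C)"
    proof (rule SUP_cong[OF refl])
      fix C assume "C \<in> \<D>"
      with that show "p ` C = C" by (intro inv_C) (rule subsetD)
    qed
    finally have inv: "p ` \<Union>\<D> = \<Union>\<D>"
      by simp
    have "\<Union>\<D> \<subseteq> A"
    proof (rule Union_least)
      fix C assume "C \<in> \<D>"
      with that show "C \<subseteq> A" by (intro sub) (rule subsetD)
    qed
    then show ?thesis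
      using perm_restrict_permutes[OF p _ inv] finite_subset[OF _ A] permutation_permutes by blast
  qed
  have "finite \<C>"
    using assms finite_subset by blast
  then show ?thesis
    using \<open>\<C> \<subseteq> orbit p ` A\<close>
  proof (induction \<C>)
    case empty
    have "perm_restrict p {} = id"
      by (auto simp: perm_restrict_def)
    then show ?case by simp
  next
    case (insert C \<C>)
    have "D \<inter> C = {}" if "D \<in> \<C>" for D
    proof -
      have "D \<in> orbit p ` A" "C \<in> orbit p ` A"
        using that insert.prems by (simp_all add: subset_iff)
      then have "D \<in> range (orbit p)" "C \<in> range (orbit p)"
        by (simp_all add: image_iff) blast+
      moreover have "D \<noteq> C"
        using that insert.hyps by meson
      ultimately show ?thesis
        using pairwiseD[OF pairwise_disjnt_orbits[OF perm]] by (simp add: disjnt_def)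
    qed
    then have disj: "\<Union>\<C> \<inter> C = {}"
      by blast
    have "sign (perm_restrict p (\<Union>(insert C \<C>))) = sign (perm_restrict p (\<Union>\<C>) \<circ> perm_restrict p C)"
      using perm_restrict_comp[OF disj] cyc insert.prems by (simp add: Un_commute)
    also have "\<dots> = sign (perm_restrict p (\<Union>\<C>)) * sign (perm_restrict p C)"
      using perm_r[of \<C>] perm_r[of "{C}"] insert.prems by (simp add: sign_compose)
    also have "sign (perm_restrict p C) = (-1) ^ (card C - 1)"
      using insert.prems sign_perm_restrict_orbit[OF perm] by auto
    finally show ?case
      using insert by (simp add: mult.commute)
  qed
qed

text \<open>
  The invariant subsets of \<open>A\<close> index the nonzero terms of the Leibniz expansion below; as unions
  of orbits they turn that expansion into a product over the orbits.
\<close>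

lemma bij_betw_Union_orbits:
  assumes p: "p permutes A" and A: "finite A"
  shows "bij_betw \<Union> (Pow (orbit p ` A)) {S. S \<subseteq> A \<and> p ` S = S}"
proof (rule bij_betw_byWitness[where f' = "\<lambda>S. orbit p ` S"])
  have perm: "permutation p"
    using p A permutation_permutes by blast
  have self: "x \<in> orbit p x" for x
    by (rule permutation_self_in_orbit[OF perm])
  have orbit_inv: "orbit p x \<subseteq> S" if "x \<in> S" "p ` S = S" for x S
  proof
    fix y assume "y \<in> orbit p x"
    then show "y \<in> S" using that by induction auto
  qed
  have orbit_eq: "orbit p x = orbit p y" if "x \<in> orbit p y" for x y
    using that cyclic_on_orbit'[OF perm] orbit_cyclic_eq3 by metis
  show "\<forall>\<C>\<in>Pow (orbit p ` A). orbit p ` \<Union>\<C> = \<C>"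
  proof
    fix \<C> assume C: "\<C> \<in> Pow (orbit p ` A)"
    have "orbit p x \<in> \<C>" if "x \<in> C" "C \<in> \<C>" for x C
    proof -
      have "orbit p x = C"
        using that C orbit_eq by blast
      then show ?thesis using that by simp
    qed
    moreover have "C \<in> orbit p ` \<Union>\<C>" if "C \<in> \<C>" for C
      using that C self by blast
    ultimately show "orbit p ` \<Union>\<C> = \<C>"
      by blast
  qed
  show "\<forall>S\<in>{S. S \<subseteq> A \<and> p ` S = S}. \<Union>(orbit p ` S) = S"
    using orbit_inv self by blast
  show "\<Union> ` Pow (orbit p ` A) \<subseteq> {S. S \<subseteq> A \<and> p ` S = S}"
  proof safe
    fix \<C> C x assume "\<C> \<subseteq> orbit p ` A" "C \<in> \<C>" "x \<in> C"
    then obtain y where y: "y \<in> A" "C = orbit p y" by blast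
    then show "x \<in> A"
      using \<open>x \<in> C\<close> permutes_orbit_subset[OF p] by blast
    show "p x \<in> \<Union>\<C>"
      using y \<open>x \<in> C\<close> \<open>C \<in> \<C>\<close> by (auto intro: orbit.step)
    show "x \<in> p ` \<Union>\<C>"
      using y \<open>x \<in> C\<close> \<open>C \<in> \<C>\<close> image_orbit[OF p A, of y] by blast
  qed
  show "image (orbit p) ` {S. S \<subseteq> A \<and> p ` S = S} \<subseteq> Pow (orbit p ` A)"
    by blast
qed

text \<open>
  The summand vanishes unless \<open>p\<close> agrees with \<open>\<sigma>\<close> on \<open>S\<close> and is the identity elsewhere. Only
  one function has this property, and it is a permutation iff \<open>S\<close> is invariant under \<open>\<sigma>\<close>.
\<close>

lemma sum_permutes_agreeing:
  fixes g :: "('b \<Rightarrow> 'b) \<Rightarrow> 'a :: comm_ring_1" and c :: 'a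
  assumes \<sigma>: "\<sigma> permutes A" and A: "finite A" and S: "S \<subseteq> A"
  shows "(\<Sum>p | p permutes A.
            g p * ((\<Prod>j\<in>S. if p j = \<sigma> j then c else 0) * (\<Prod>j\<in>A - S. if p j = j then 1 else 0))) =
         (if \<sigma> ` S = S then g (perm_restrict \<sigma> S) * c ^ card S else 0)"
proof -
  let ?q = "perm_restrict \<sigma> S"
  have fin: "finite S" "finite (A - S)"
    using A S finite_subset by auto
  have term_eq: "(\<Prod>j\<in>S. if p j = \<sigma> j then c else 0) * (\<Prod>j\<in>A - S. if p j = j then 1 else 0) =
      (if p = ?q then c ^ card S else 0)" if p: "p permutes A" for p
  proof (cases "p = ?q")
    case True
    then show ?thesis
      by (simp add: perm_restrict_def)
  next
    case False
    then obtain j where j: "p j \<noteq> ?q j"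
      by blast
    then have "j \<in> A"
      using p \<sigma> S by (metis perm_restrict_simps(2) permutes_not_in subsetD)
    show ?thesis
    proof (cases "j \<in> S")
      case True
      with j have "(\<Prod>j\<in>S. if p j = \<sigma> j then c else 0) = 0"
        by (intro prod_zero[OF fin(1)]) (auto simp: perm_restrict_def)
      with False show ?thesis by simp
    next
      case False
      with j \<open>j \<in> A\<close> have "(\<Prod>j\<in>A - S. if p j = j then 1 else 0 :: 'a) = 0"
        by (intro prod_zero[OF fin(2)]) (auto simp: perm_restrict_def)
      with \<open>p \<noteq> ?q\<close> show ?thesis by simp
    qed
  qed
  have "?q permutes A \<longleftrightarrow> \<sigma> ` S = S"
  proof
    assume q: "?q permutes A"
    have "\<sigma> ` S \<subseteq> S"
    proof
      fix y assume "y \<in> \<sigma> ` S"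
      then obtain x where x: "x \<in> S" "y = ?q x"
        by (auto simp: perm_restrict_def)
      show "y \<in> S"
      proof (rule ccontr)
        assume "y \<notin> S"
        then have "?q y = ?q x"
          using x by (simp add: perm_restrict_def)
        then have "y = x"
          using injD[OF permutes_inj[OF q]] by blast
        then show False
          using x \<open>y \<notin> S\<close> by simp
      qed
    qed
    then show "\<sigma> ` S = S"
      using endo_inj_surj[OF fin(1)] inj_on_subset[OF permutes_inj[OF \<sigma>]] by blast
  next
    assume "\<sigma> ` S = S"
    then show "?q permutes A"
      using perm_restrict_permutes[OF \<sigma> S] permutes_subset S by blast
  qed
  moreover have "(\<Sum>p | p permutes A.
      g p * ((\<Prod>j\<in>S. if p j = \<sigma> j then c else 0) * (\<Prod>j\<in>A - S. if p j = j then 1 else 0))) =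
      (\<Sum>p | p permutes A. if p = ?q then g ?q * c ^ card S else 0)"
    by (rule sum.cong[OF refl], subst term_eq) auto
  ultimately show ?thesis
    using finite_permutations[OF A] by simp
qed

lemma card_orbit_pos:
  assumes "p permutes A" and "finite A"
  shows "0 < card (orbit p x)"
  using finite_cyclic_on[OF cyclic_on_orbit[OF assms]] orbit_nonempty by (simp add: card_gt_0_iff)

text \<open>
  Every entry of the matrix is a sum of an entry of \<open>-c P\<close> and an entry of \<open>I\<close>. Expanding the
  products in the Leibniz formula, one chooses the set \<open>S\<close> of columns in which \<open>-c P\<close> is used.
  By the previous lemma only invariant \<open>S\<close> survive, each with a single permutation; the orbit \<open>C\<close>
  then contributes \<open>1\<close> or \<open>(-1)\<^bsup>|C| - 1\<^esup> (-c)\<^bsup>|C|\<^esup> = -c\<^bsup>|C|\<^esup>\<close>, according to whether it lies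
  outside or inside \<open>S\<close>.
\<close>

theorem det_one_minus_perm_mat:
  fixes c :: "'a :: comm_ring_1"
  assumes \<sigma>: "\<sigma> permutes {..<n}"
  shows "det (1\<^sub>m n - c \<cdot>\<^sub>m perm_mat n \<sigma>) = (\<Prod>C\<in>orbit \<sigma> ` {..<n}. 1 - c ^ card C)"
proof -
  let ?A = "{..<n}"
  let ?O = "orbit \<sigma> ` ?A"
  let ?M = "1\<^sub>m n - c \<cdot>\<^sub>m perm_mat n \<sigma> :: 'a mat"
  let ?sgn = "\<lambda>p :: nat \<Rightarrow> nat. (of_int (sign p) :: 'a)"
  have perm: "permutation \<sigma>"
    using \<sigma> permutation_permutes by blast
  have M: "?M \<in> carrier_mat n n"
    by (auto simp: perm_mat_def)
  have entry: "?M $$ (p j, j) = (if p j = \<sigma> j then - c else 0) + (if p j = j then 1 else 0)"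
    if "p permutes ?A" "j < n" for p j
    using that permutes_in_image[OF that(1), of j] by (simp add: perm_mat_def)
  have card_pos: "card C > 0" if "C \<in> ?O" for C
    using that card_orbit_pos[OF \<sigma> finite_lessThan] by blast
  have "det ?M = (\<Sum>p | p permutes ?A. ?sgn p * (\<Prod>j<n. ?M $$ (p j, j)))"
    using det_col[OF M] by (simp add: atLeast0LessThan)
  also have "\<dots> = (\<Sum>p | p permutes ?A. \<Sum>S\<in>Pow ?A. ?sgn p *
      ((\<Prod>j\<in>S. if p j = \<sigma> j then - c else 0) * (\<Prod>j\<in>?A - S. if p j = j then 1 else 0)))"
  proof (rule sum.cong[OF refl])
    fix p assume "p \<in> {p. p permutes ?A}"
    then have "(\<Prod>j<n. ?M $$ (p j, j)) =
        (\<Prod>j<n. (if p j = \<sigma> j then - c else 0) + (if p j = j then 1 else 0))"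
      using entry by (intro prod.cong) auto
    then show "?sgn p * (\<Prod>j<n. ?M $$ (p j, j)) = (\<Sum>S\<in>Pow ?A. ?sgn p *
      ((\<Prod>j\<in>S. if p j = \<sigma> j then - c else 0) * (\<Prod>j\<in>?A - S. if p j = j then 1 else 0)))"
      by (simp only: prod_add[OF finite_lessThan] sum_distrib_left)
  qed
  also have "\<dots> = (\<Sum>S\<in>Pow ?A. \<Sum>p | p permutes ?A. ?sgn p *
      ((\<Prod>j\<in>S. if p j = \<sigma> j then - c else 0) * (\<Prod>j\<in>?A - S. if p j = j then 1 else 0)))"
    by (rule sum.swap)
  also have "\<dots> = (\<Sum>S\<in>Pow ?A.
      if \<sigma> ` S = S then ?sgn (perm_restrict \<sigma> S) * (- c) ^ card S else 0)"
    by (intro sum.cong refl sum_permutes_agreeing[OF \<sigma>]) auto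
  also have "\<dots> = (\<Sum>S | S \<subseteq> ?A \<and> \<sigma> ` S = S. ?sgn (perm_restrict \<sigma> S) * (- c) ^ card S)"
    by (rule sum.mono_neutral_cong_right) auto
  also have "\<dots> = (\<Sum>\<C>\<in>Pow ?O. ?sgn (perm_restrict \<sigma> (\<Union>\<C>)) * (- c) ^ card (\<Union>\<C>))"
    by (rule sum.reindex_bij_betw[OF bij_betw_Union_orbits[OF \<sigma>], symmetric]) simp
  also have "\<dots> = (\<Sum>\<C>\<in>Pow ?O. (\<Prod>C\<in>\<C>. - (c ^ card C)) * (\<Prod>C\<in>?O - \<C>. 1))"
  proof (rule sum.cong[OF refl])
    fix \<C> assume C: "\<C> \<in> Pow ?O"
    have "card (\<Union>\<C>) = (\<Sum>C\<in>\<C>. card C)"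
    proof (rule card_Union_disjoint)
      show "pairwise disjnt \<C>"
        using C by (intro pairwise_subset[OF pairwise_disjnt_orbits[OF perm]]) auto
      show "finite C" if "C \<in> \<C>" for C
        using that C card_pos card_gt_0_iff by blast
    qed
    then have "?sgn (perm_restrict \<sigma> (\<Union>\<C>)) * (- c) ^ card (\<Union>\<C>) =
        (\<Prod>C\<in>\<C>. (-1) ^ (card C - 1) * (- c) ^ card C)"
      using C by (simp add: sign_perm_restrict_Union_orbits[OF \<sigma>] power_sum prod.distrib)
    also have "\<dots> = (\<Prod>C\<in>\<C>. - (c ^ card C))"
    proof (rule prod.cong[OF refl])
      fix C assume "C \<in> \<C>"
      then obtain l where l: "card C = Suc l"
        using C card_pos gr0_implies_Suc by blast
      have "(-1 :: 'a) ^ l * (- c) ^ l = c ^ l"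
        by (simp flip: power_mult_distrib)
      then show "(-1) ^ (card C - 1) * (- c) ^ card C = - (c ^ card C)"
        using l by (simp add: mult.left_commute)
    qed
    finally show "?sgn (perm_restrict \<sigma> (\<Union>\<C>)) * (- c) ^ card (\<Union>\<C>) =
        (\<Prod>C\<in>\<C>. - (c ^ card C)) * (\<Prod>C\<in>?O - \<C>. 1)"
      by simp
  qed
  also have "\<dots> = (\<Prod>C\<in>?O. - (c ^ card C) + 1)"
    by (subst prod_add) simp_all
  finally show ?thesis
    by simp
qed

section \<open>Fixed lattice points as solutions in a box\<close>

text \<open>
  For cycles \<open>A\<close> with lengths \<open>w\<close> this is the set \<open>\<Phi>\<^sub>l(\<sigma>, z)\<close>. The index set is arbitrary
  because the same count is needed for cycles as sets and for their positions in a list of lengths.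
\<close>

definition box_solutions :: "'b set \<Rightarrow> ('b \<Rightarrow> nat) \<Rightarrow> nat \<Rightarrow> int \<Rightarrow> ('b \<Rightarrow> nat) set" where
  "box_solutions A w l z = {f \<in> A \<rightarrow>\<^sub>E {0..<l}. int (\<Sum>i\<in>A. f i * w i) = z}"

lemma mem_dilate_lattice_points_iff:
  assumes d: "0 < d"
  shows "x \<in> dilate_lattice_points k n d \<longleftrightarrow>
    x \<in> carrier_vec n \<and> (\<forall>i<n. 0 \<le> x $ i \<and> x $ i \<le> real d \<and> x $ i \<in> \<int>) \<and>
    (\<Sum>i<n. x $ i) = real (k * d)"
    (is "_ \<longleftrightarrow> ?R")
proof
  assume x: "x \<in> dilate_lattice_points k n d"
  then obtain y where y: "y \<in> hypersimplex k n" "x = real d \<cdot>\<^sub>v y"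
    by (auto simp: dilate_lattice_points_def)
  then have car: "y \<in> carrier_vec n" and bd: "\<And>i. i < n \<Longrightarrow> 0 \<le> y $ i \<and> y $ i \<le> 1"
    and su: "(\<Sum>i<n. y $ i) = real k"
    by (auto simp: hypersimplex_def)
  have xi: "x $ i = real d * y $ i" if "i < n" for i
    using that car y(2) by simp
  have "(\<Sum>i<n. x $ i) = (\<Sum>i<n. real d * y $ i)"
    by (intro sum.cong refl) (simp add: xi)
  also have "\<dots> = real (k * d)"
    by (simp add: su flip: sum_distrib_left)
  finally have "(\<Sum>i<n. x $ i) = real (k * d)" .
  moreover have "0 \<le> x $ i \<and> x $ i \<le> real d" if "i < n" for i
    using bd[OF that] xi[OF that] by (simp add: mult_left_le)
  ultimately show ?R
    using x by (simp add: dilate_lattice_points_def)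
next
  assume R: ?R
  define y where "y = (1 / real d) \<cdot>\<^sub>v x"
  have "x = real d \<cdot>\<^sub>v y"
    using d by (simp add: y_def smult_smult_assoc)
  moreover have yi: "y $ i = x $ i / real d" if "i < n" for i
    using R that by (auto simp: y_def)
  have "y \<in> hypersimplex k n"
    unfolding hypersimplex_def
  proof (intro CollectI conjI allI impI)
    show "y \<in> carrier_vec n"
      using R by (simp add: y_def)
    show "0 \<le> y $ i" "y $ i \<le> 1" if "i < n" for i
      using R d that by (simp_all add: yi)
    have "(\<Sum>i<n. y $ i) = (\<Sum>i<n. x $ i) / real d"
      unfolding sum_divide_distrib by (intro sum.cong refl) (simp add: yi)
    then show "(\<Sum>i<n. y $ i) = real k"
      using R d by simp
  qed
  ultimately show "x \<in> dilate_lattice_points k n d"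
    using R by (simp add: dilate_lattice_points_def)
qed

lemma permute_coords_fixed_iff:
  assumes \<sigma>: "\<sigma> permutes {..<n}" and x: "x \<in> carrier_vec n"
  shows "permute_coords \<sigma> x = x \<longleftrightarrow> (\<forall>i<n. x $ \<sigma> i = x $ i)"
proof -
  have lt: "\<sigma> i < n \<longleftrightarrow> i < n" "inv_into UNIV \<sigma> i < n \<longleftrightarrow> i < n" for i
    using permutes_in_image[OF \<sigma>, of i] permutes_in_image[OF permutes_inv[OF \<sigma>], of i] by auto
  have "permute_coords \<sigma> x = x \<longleftrightarrow> (\<forall>i<n. x $ inv_into UNIV \<sigma> i = x $ i)"
    using x by (auto simp: permute_coords_def vec_eq_iff)
  also have "\<dots> \<longleftrightarrow> (\<forall>i<n. x $ \<sigma> i = x $ i)"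
    using lt permutes_inverses[OF \<sigma>] by metis
  finally show ?thesis .
qed

lemma sum_over_orbits:
  fixes f :: "'b set \<Rightarrow> 'a :: comm_semiring_1"
  assumes p: "(p :: 'b \<Rightarrow> 'b) permutes A" and A: "finite A"
  shows "(\<Sum>i\<in>A. f (orbit p i)) = (\<Sum>C\<in>orbit p ` A. f C * of_nat (card C))"
proof -
  have perm: "permutation p"
    using p A permutation_permutes by blast
  have fibre: "{i \<in> A. orbit p i = C} = C" if C: "C \<in> orbit p ` A" for C
  proof -
    obtain a where a: "a \<in> A" "C = orbit p a"
      using C by blast
    have "orbit p i = C \<longleftrightarrow> i \<in> C" for i
      using a(2) permutation_self_in_orbit[OF perm, of i]
        orbit_cyclic_eq3[OF cyclic_on_orbit'[OF perm, of a], of i] by blast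
    moreover have "C \<subseteq> A"
      using a permutes_orbit_subset[OF p] by simp
    ultimately show ?thesis by auto
  qed
  have "(\<Sum>i\<in>A. f (orbit p i)) = (\<Sum>C\<in>orbit p ` A. \<Sum>i | i \<in> A \<and> orbit p i = C. f (orbit p i))"
    using A by (rule sum.image_gen)
  also have "\<dots> = (\<Sum>C\<in>orbit p ` A. f C * of_nat (card C))"
  proof (rule sum.cong[OF refl])
    fix C assume C: "C \<in> orbit p ` A"
    have "(\<Sum>i | i \<in> A \<and> orbit p i = C. f (orbit p i)) = (\<Sum>i | i \<in> A \<and> orbit p i = C. f C)"
      by (rule sum.cong) auto
    then show "(\<Sum>i | i \<in> A \<and> orbit p i = C. f (orbit p i)) = f C * of_nat (card C)"
      using fibre[OF C] by (simp add: mult.commute)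
  qed
  finally show ?thesis .
qed

text \<open>
  A fixed vector is constant on the cycles of \<open>\<sigma>\<close>, so it is given by its value on each cycle. The
  values on cycles range over \<open>{0, \<dots>, d}\<close>, which is why the box has side \<open>Suc d\<close>, and the cycle
  \<open>C\<close> contributes \<open>|C|\<close> equal coordinates to the coordinate sum.
\<close>

lemma card_fixed_lattice_points:
  assumes \<sigma>: "\<sigma> permutes {..<n}" and d: "0 < d"
  shows "card {x \<in> dilate_lattice_points k n d. permute_coords \<sigma> x = x} =
    card (box_solutions (orbit \<sigma> ` {..<n}) card (Suc d) (int (k * d)))"
proof -
  let ?A = "{..<n}"
  let ?O = "orbit \<sigma> ` ?A"
  let ?B = "box_solutions ?O card (Suc d) (int (k * d))"
  let ?X = "{x \<in> dilate_lattice_points k n d. permute_coords \<sigma> x = x}"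
  let ?vec = "\<lambda>a. vec n (\<lambda>i. real (a (orbit \<sigma> i)))"
  have perm: "permutation \<sigma>"
    using \<sigma> permutation_permutes by blast
  have orbit_step: "orbit \<sigma> (\<sigma> i) = orbit \<sigma> i" for i
    using orbit_cyclic_eq3[OF cyclic_on_orbit'[OF perm, of i]] by (simp add: orbit.base)
  have sum_vec: "(\<Sum>i<n. ?vec a $ i) = real (\<Sum>C\<in>?O. a C * card C)" for a
    using sum_over_orbits[OF \<sigma> finite_lessThan, of "\<lambda>C. real (a C)"] by simp
  have mem: "?vec a \<in> ?X \<longleftrightarrow> (\<forall>C\<in>?O. a C \<le> d) \<and> (\<Sum>C\<in>?O. a C * card C) = k * d" for a
  proof -
    have "permute_coords \<sigma> (?vec a) = ?vec a"
      using permutes_in_image[OF \<sigma>]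
      by (subst permute_coords_fixed_iff[OF \<sigma>]) (auto simp: orbit_step)
    then have "?vec a \<in> ?X \<longleftrightarrow> (\<forall>C\<in>?O. a C \<le> d) \<and> (\<Sum>i<n. ?vec a $ i) = real (k * d)"
      by (auto simp: mem_dilate_lattice_points_iff[OF d])
    then show ?thesis
      unfolding sum_vec of_nat_eq_iff .
  qed
  have "bij_betw ?vec ?B ?X"
  proof (rule bij_betw_imageI)
    show "inj_on ?vec ?B"
    proof (rule inj_onI)
      fix a b assume ab: "a \<in> ?B" "b \<in> ?B" "?vec a = ?vec b"
      have eq: "a C = b C" if "C \<in> ?O" for C
      proof -
        obtain i where "i < n" "C = orbit \<sigma> i" using \<open>C \<in> ?O\<close> by blast
        then show ?thesis
          using arg_cong[OF ab(3), of "\<lambda>v. v $ i"] by simp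
      qed
      have "a \<in> ?O \<rightarrow>\<^sub>E {0..<Suc d}" "b \<in> ?O \<rightarrow>\<^sub>E {0..<Suc d}"
        using ab(1,2) by (simp_all only: box_solutions_def mem_Collect_eq)
      then show "a = b"
        using eq by (rule PiE_ext)
    qed
    show "?vec ` ?B = ?X"
    proof (intro equalityI subsetI)
      fix x assume "x \<in> ?vec ` ?B"
      then obtain a where a: "a \<in> ?B" "x = ?vec a" by blast
      then have a_PiE: "a \<in> ?O \<rightarrow>\<^sub>E {0..<Suc d}" and sum_a: "(\<Sum>C\<in>?O. a C * card C) = k * d"
        by (simp_all only: box_solutions_def mem_Collect_eq of_nat_eq_iff)
      have "a C \<le> d" if "C \<in> ?O" for C
        using PiE_mem[OF a_PiE that] by (simp add: less_Suc_eq_le)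
      then show "x \<in> ?X"
        unfolding a(2) mem using sum_a by blast
    next
      fix x assume x: "x \<in> ?X"
      then have car: "x \<in> carrier_vec n" and ge: "\<And>i. i < n \<Longrightarrow> 0 \<le> x $ i"
        and int: "\<And>i. i < n \<Longrightarrow> x $ i \<in> \<int>"
        by (auto simp: mem_dilate_lattice_points_iff[OF d])
      have step: "x $ \<sigma> i = x $ i" if "i < n" for i
        using x that permute_coords_fixed_iff[OF \<sigma> car] by blast
      have const: "j < n \<and> x $ j = x $ i" if "j \<in> orbit \<sigma> i" "i < n" for i j
        using that
        by induction (use step permutes_in_image[OF \<sigma>] in auto)
      (* The inverse map: the value of x at any chosen point of each orbit. *)
      define a where "a = restrict (\<lambda>C. nat \<lfloor>x $ (SOME j. j \<in> C)\<rfloor>) ?O"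
      have a_orbit: "real (a (orbit \<sigma> i)) = x $ i" if "i < n" for i
      proof -
        have "(SOME j. j \<in> orbit \<sigma> i) \<in> orbit \<sigma> i"
          using permutation_self_in_orbit[OF perm] by (rule someI)
        then have "x $ (SOME j. j \<in> orbit \<sigma> i) = x $ i"
          using const[OF _ that] by blast
        then have "a (orbit \<sigma> i) = nat \<lfloor>x $ i\<rfloor>"
          using that by (simp add: a_def)
        moreover have "real_of_int \<lfloor>x $ i\<rfloor> = x $ i"
          using int[OF that] by (rule of_int_floor)
        ultimately show ?thesis
          using ge[OF that] by simp
      qed
      have x_eq: "x = ?vec a"
        using car a_orbit by (intro eq_vecI) auto
      then have "?vec a \<in> ?X"
        using x by simp
      then have le: "\<forall>C\<in>?O. a C \<le> d" and sum_a: "(\<Sum>C\<in>?O. a C * card C) = k * d"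
        unfolding mem by blast+
      have "a \<in> extensional ?O"
        unfolding a_def by (rule restrict_extensional)
      with le have "a \<in> ?O \<rightarrow>\<^sub>E {0..<Suc d}"
        by (simp add: PiE_iff less_Suc_eq_le)
      then have "a \<in> ?B"
        using sum_a by (simp only: box_solutions_def mem_Collect_eq of_nat_eq_iff)
      with x_eq show "x \<in> ?vec ` ?B" by blast
    qed
  qed
  then show ?thesis
    by (rule bij_betw_same_card[symmetric])
qed

section \<open>Products of power series in powers of \<open>X\<close>\<close>

no_notation vec_index (infixl "$" 100)
unbundle fps_syntax

lemma fps_nth_compose_X_power:
  fixes F :: "'a :: comm_ring_1 fps"
  assumes "0 < w"
  shows "(F oo fps_X ^ w) $ N = (if w dvd N then F $ (N div w) else 0)"
proof -
  have "(F oo fps_X ^ w) $ N = (\<Sum>i = 0..N. if w dvd N \<and> i = N div w then F $ i else 0)"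
    unfolding fps_compose_nth
    by (rule sum.cong[OF refl]) (use assms in \<open>auto simp flip: power_mult\<close>)
  also have "\<dots> = (if w dvd N then F $ (N div w) else 0)"
    by simp
  finally show ?thesis .
qed

lemma finite_weighted_functions:
  fixes w :: "'b \<Rightarrow> nat"
  assumes A: "finite A" and w: "\<And>i. i \<in> A \<Longrightarrow> 0 < w i"
  shows "finite {f \<in> A \<rightarrow>\<^sub>E UNIV. (\<Sum>i\<in>A. f i * w i) = N}"
proof (rule finite_subset)
  show "{f \<in> A \<rightarrow>\<^sub>E UNIV. (\<Sum>i\<in>A. f i * w i) = N} \<subseteq> A \<rightarrow>\<^sub>E {..N}"
  proof
    fix f assume f: "f \<in> {f \<in> A \<rightarrow>\<^sub>E UNIV. (\<Sum>i\<in>A. f i * w i) = N}"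
    have "f i \<le> N" if "i \<in> A" for i
    proof -
      have "f i \<le> f i * w i"
        using w[OF that] by simp
      also have "\<dots> \<le> (\<Sum>i\<in>A. f i * w i)"
        using A that by (intro member_le_sum) auto
      finally show ?thesis using f by simp
    qed
    with f show "f \<in> A \<rightarrow>\<^sub>E {..N}"
      by (auto simp: PiE_def)
  qed
qed (use A in \<open>simp add: finite_PiE\<close>)

text \<open>
  The common source of both kinds of combinatorial sums in the formula: with truncated geometric
  series for \<open>F\<close> it counts the elements of \<open>\<Phi>\<^sub>l\<close>, and with powers of \<open>1 - X\<close> it produces the signed
  products of binomial coefficients.
\<close>

theorem fps_nth_prod_compose_X_power:
  fixes F :: "'b \<Rightarrow> 'a :: comm_ring_1 fps"
  assumes "finite A" and "\<And>i. i \<in> A \<Longrightarrow> 0 < w i"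
  shows "(\<Prod>i\<in>A. F i oo fps_X ^ w i) $ N =
    (\<Sum>f | f \<in> A \<rightarrow>\<^sub>E UNIV \<and> (\<Sum>i\<in>A. f i * w i) = N. \<Prod>i\<in>A. F i $ f i)"
  using assms
proof (induction A arbitrary: N rule: finite_induct)
  case empty
  show ?case
    by (cases "N = 0") (simp_all add: PiE_empty_domain)
next
  case (insert a A)
  define T where "T M = {f \<in> A \<rightarrow>\<^sub>E UNIV. (\<Sum>i\<in>A. f i * w i) = M}" for M
  define J where "J = {j. j * w a \<le> N}"
  have w: "0 < w a"
    using insert.prems by simp
  have J_le: "j \<le> N" if "j \<in> J" for j
    using that w le_trans[of j "j * w a" N] by (simp add: J_def)
  then have J: "finite J"
    using finite_subset[of J "{..N}"] by auto
  have T: "finite (T M)" for M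
    unfolding T_def using insert.hyps insert.prems by (intro finite_weighted_functions) auto
  have IH: "(\<Prod>i\<in>A. F i oo fps_X ^ w i) $ M = (\<Sum>f\<in>T M. \<Prod>i\<in>A. F i $ f i)" for M
    unfolding T_def using insert.IH insert.prems by simp
  have "(\<Prod>i\<in>insert a A. F i oo fps_X ^ w i) $ N =
      (\<Sum>q = 0..N. (F a oo fps_X ^ w a) $ q * (\<Prod>i\<in>A. F i oo fps_X ^ w i) $ (N - q))"
    using insert.hyps by (simp add: fps_mult_nth)
  also have "\<dots> = (\<Sum>q\<in>(\<lambda>j. j * w a) ` J.
      (F a oo fps_X ^ w a) $ q * (\<Prod>i\<in>A. F i oo fps_X ^ w i) $ (N - q))"
  proof (rule sum.mono_neutral_right)
    show "\<forall>q\<in>{0..N} - (\<lambda>j. j * w a) ` J.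
        (F a oo fps_X ^ w a) $ q * (\<Prod>i\<in>A. F i oo fps_X ^ w i) $ (N - q) = 0"
      by (auto simp: fps_nth_compose_X_power[OF w] J_def image_iff elim!: dvdE)
         (metis mult.commute)
  qed (auto simp: J_def)
  also have "\<dots> = (\<Sum>j\<in>J. F a $ j * (\<Prod>i\<in>A. F i oo fps_X ^ w i) $ (N - j * w a))"
    using w by (subst sum.reindex) (auto simp: inj_on_def fps_nth_compose_X_power[OF w])
  also have "\<dots> = (\<Sum>j\<in>J. \<Sum>f\<in>T (N - j * w a). F a $ j * (\<Prod>i\<in>A. F i $ f i))"
    by (simp add: IH sum_distrib_left)
  also have "\<dots> = (\<Sum>(j, f)\<in>(SIGMA j:J. T (N - j * w a)). F a $ j * (\<Prod>i\<in>A. F i $ f i))"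
    using J T by (intro sum.Sigma) auto
  also have "\<dots> = (\<Sum>f | f \<in> insert a A \<rightarrow>\<^sub>E UNIV \<and> (\<Sum>i\<in>insert a A. f i * w i) = N.
      \<Prod>i\<in>insert a A. F i $ f i)"
  proof (rule sum.reindex_bij_witness[where j = "\<lambda>(j, f). f(a := j)"
        and i = "\<lambda>f. (f a, f(a := undefined))"], goal_cases)
    case (1 x)
    then show ?case
      using insert.hyps by (auto simp: T_def PiE_def extensional_def fun_eq_iff)
  next
    case (2 x)
    obtain j f where x: "x = (j, f)" by (cases x)
    have "(\<Sum>i\<in>A. (f(a := j)) i * w i) = (\<Sum>i\<in>A. f i * w i)"
      using insert.hyps by (intro sum.cong) auto
    then show ?case
      using 2 insert.hyps by (auto simp: x T_def J_def PiE_def extensional_def)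
  next
    case (3 f)
    then show ?case by simp
  next
    case (4 f)
    have "(\<Sum>i\<in>A. (f(a := undefined)) i * w i) = (\<Sum>i\<in>A. f i * w i)"
      using insert.hyps by (intro sum.cong) auto
    then show ?case
      using 4 insert.hyps by (auto simp: T_def J_def PiE_def extensional_def)
  next
    case (5 x)
    obtain j f where x: "x = (j, f)" by (cases x)
    have "(\<Prod>i\<in>A. F i $ (f(a := j)) i) = (\<Prod>i\<in>A. F i $ f i)"
      using insert.hyps by (intro prod.cong) auto
    then show ?case
      using insert.hyps by (simp add: x)
  qed
  finally show ?case .
qed

section \<open>The generating function of solutions in a box\<close>

definition denominator :: "'b set \<Rightarrow> ('b \<Rightarrow> nat) \<Rightarrow> 'a :: comm_ring_1 fps" where
  "denominator A w = (\<Prod>i\<in>A. 1 - fps_X ^ w i)"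

lemma box_solutions_negative: "z < 0 \<Longrightarrow> box_solutions A w l z = {}"
  by (auto simp: box_solutions_def simp del: of_nat_sum)

lemma denominator_nth_0:
  assumes "\<And>i. i \<in> A \<Longrightarrow> 0 < w i"
  shows "denominator A w $ 0 = 1"
  unfolding denominator_def using assms
  by (induction A rule: infinite_finite_induct) simp_all

lemma card_box_solutions_eq_nth:
  assumes A: "finite A" and w: "\<And>i. i \<in> A \<Longrightarrow> 0 < w i"
  shows "(of_nat (card (box_solutions A w l (int N))) :: 'a :: comm_ring_1) =
    (\<Prod>i\<in>A. Abs_fps (\<lambda>j. if j < l then 1 else 0) oo fps_X ^ w i) $ N"
proof -
  let ?S = "{f. f \<in> A \<rightarrow>\<^sub>E UNIV \<and> (\<Sum>i\<in>A. f i * w i) = N}"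
  have "(\<Prod>i\<in>A. Abs_fps (\<lambda>j. if j < l then 1 else (0::'a)) oo fps_X ^ w i) $ N =
      (\<Sum>f\<in>?S. \<Prod>i\<in>A. if f i < l then 1 else 0)"
    using A w by (simp add: fps_nth_prod_compose_X_power)
  also have "\<dots> = (\<Sum>f\<in>box_solutions A w l (int N). 1)"
  proof (rule sum.mono_neutral_cong_right)
    show "finite ?S"
      using finite_weighted_functions[OF A w] by simp
    show "box_solutions A w l (int N) \<subseteq> ?S"
      by (auto simp: box_solutions_def simp del: of_nat_sum)
    show "\<forall>f\<in>?S - box_solutions A w l (int N). (\<Prod>i\<in>A. if f i < l then 1 else (0::'a)) = 0"
    proof
      fix f assume f: "f \<in> ?S - box_solutions A w l (int N)"
      then obtain i where "i \<in> A" "\<not> f i < l"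
        by (auto simp: box_solutions_def PiE_iff simp del: of_nat_sum)
      then show "(\<Prod>i\<in>A. if f i < l then 1 else (0::'a)) = 0"
        using A by (intro prod_zero) auto
    qed
    show "(\<Prod>i\<in>A. if f i < l then 1 else (0::'a)) = 1" if "f \<in> box_solutions A w l (int N)" for f
      using that by (intro prod.neutral) (auto simp: box_solutions_def)
  qed
  finally show ?thesis by simp
qed

lemma truncated_geometric_series:
  fixes l :: nat
  shows "Abs_fps (\<lambda>j. if j < l then 1 else 0) * (1 - fps_X) = (1 - fps_X ^ l :: 'a :: comm_ring_1 fps)"
proof (rule fps_ext)
  fix N
  let ?G = "Abs_fps (\<lambda>j. if j < l then 1 else 0 :: 'a)"
  have "(?G * (1 - fps_X)) $ N = ?G $ N - (if N = 0 then 0 else ?G $ (N - 1))"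
    unfolding right_diff_distrib mult_1_right fps_sub_nth by simp
  then show "(?G * (1 - fps_X)) $ N = (1 - fps_X ^ l :: 'a fps) $ N"
    by (cases N) auto
qed

text \<open>
  Each factor \<open>1 + X\<^sup>w + \<dots> + X\<^bsup>(l - 1) w\<^esup>\<close> of the generating function is
  \<open>(1 - X\<^bsup>l w\<^esup>) / (1 - X\<^sup>w)\<close>, and the numerators multiply to the denominator series evaluated
  at \<open>X\<^sup>l\<close>.
\<close>

lemma card_box_solutions:
  fixes A :: "'b set"
  assumes A: "finite A" and w: "\<And>i. i \<in> A \<Longrightarrow> 0 < w i" and l: "0 < l"
  shows "(of_nat (card (box_solutions A w l (int N))) :: 'a :: field) =
    ((denominator A w oo fps_X ^ l) * inverse (denominator A w)) $ N"
proof -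
  let ?D = "denominator A w :: 'a fps"
  let ?G = "Abs_fps (\<lambda>j. if j < l then 1 else 0) :: 'a fps"
  have X: "1 - fps_X oo fps_X ^ v = (1 - fps_X ^ v :: 'a fps)" if "0 < v" for v
    using that by (simp add: fps_compose_sub_distrib)
  have "(\<Prod>i\<in>A. ?G oo fps_X ^ w i) * ?D = (\<Prod>i\<in>A. (?G oo fps_X ^ w i) * (1 - fps_X ^ w i))"
    by (simp add: denominator_def prod.distrib)
  also have "\<dots> = (\<Prod>i\<in>A. 1 - (fps_X ^ w i) oo fps_X ^ l)"
  proof (rule prod.cong[OF refl])
    fix i assume "i \<in> A"
    then have wi: "0 < w i" by (rule w)
    have "(?G oo fps_X ^ w i) * (1 - fps_X ^ w i) = (?G * (1 - fps_X)) oo fps_X ^ w i"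
      using wi by (simp add: fps_compose_mult_distrib X)
    also have "\<dots> = (1 - fps_X ^ l) oo fps_X ^ w i"
      by (simp only: truncated_geometric_series)
    also have "\<dots> = 1 - (fps_X ^ w i) ^ l"
      using wi by (simp add: fps_compose_sub_distrib flip: fps_compose_power)
    also have "\<dots> = 1 - (fps_X ^ w i) oo fps_X ^ l"
      using l by (simp add: fps_compose_sub_distrib mult.commute flip: fps_compose_power power_mult)
    finally show "(?G oo fps_X ^ w i) * (1 - fps_X ^ w i) = 1 - (fps_X ^ w i) oo fps_X ^ l" .
  qed
  also have "\<dots> = ?D oo fps_X ^ l"
    using l by (simp add: denominator_def fps_compose_prod_distrib)
  finally have "(\<Prod>i\<in>A. ?G oo fps_X ^ w i) * ?D * inverse ?D = (?D oo fps_X ^ l) * inverse ?D"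
    by simp
  moreover have "?D * inverse ?D = 1"
    by (rule inverse_mult_eq_1') (simp add: denominator_nth_0 w)
  ultimately show ?thesis
    by (simp add: card_box_solutions_eq_nth[OF A w] mult.assoc)
qed

text \<open>
  Coefficients at negative positions are \<open>0\<close>, so that the two expansions compared below have
  literally the same terms.
\<close>

definition fps_nth_int :: "'a :: zero fps \<Rightarrow> int \<Rightarrow> 'a" where
  "fps_nth_int F z = (if z < 0 then 0 else F $ nat z)"

text \<open>
  The index set \<open>J\<close> is free as long as it contains every \<open>j\<close> that can contribute; this lets one
  use ranges of \<open>j\<close> that do not depend on \<open>z\<close>, and so interchange sums.
\<close>

lemma card_box_solutions_expand:
  fixes A :: "'b set"
  assumes A: "finite A" and w: "\<And>i. i \<in> A \<Longrightarrow> 0 < w i" and l: "0 < l"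
    and J: "finite J" "\<And>j. int (l * j) \<le> z \<Longrightarrow> j \<in> J"
  shows "(of_nat (card (box_solutions A w l z)) :: 'a :: field) =
    (\<Sum>j\<in>J. denominator A w $ j * fps_nth_int (inverse (denominator A w)) (z - int (l * j)))"
proof (cases "z < 0")
  case True
  have "fps_nth_int F (z - int (l * j)) = 0" for j and F :: "'a fps"
    using True of_nat_0_le_iff[of "l * j", where ?'a = int]
    unfolding fps_nth_int_def by presburger
  then show ?thesis
    using True by (simp only: box_solutions_negative card.empty of_nat_0 mult_zero_right sum.neutral_const)
next
  case False
  define N where "N = nat z"
  with False have z: "z = int N"
    by simp
  let ?D = "denominator A w :: 'a fps"
  let ?K = "{j. l * j \<le> N}"
  have K: "?K \<subseteq> J"
  proof
    fix j assume "j \<in> ?K"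
    then have "int (l * j) \<le> z"
      using z by (simp only: mem_Collect_eq of_nat_le_iff)
    then show "j \<in> J" by (rule J(2))
  qed
  have "of_nat (card (box_solutions A w l z)) =
      (\<Sum>q = 0..N. (?D oo fps_X ^ l) $ q * inverse ?D $ (N - q))"
    unfolding z by (simp only: card_box_solutions[OF A w l] fps_mult_nth)
  also have "\<dots> = (\<Sum>q\<in>(\<lambda>j. l * j) ` ?K. (?D oo fps_X ^ l) $ q * inverse ?D $ (N - q))"
    by (rule sum.mono_neutral_right) (auto simp: fps_nth_compose_X_power[OF l] image_iff elim!: dvdE)
  also have "\<dots> = (\<Sum>j\<in>?K. ?D $ j * inverse ?D $ (N - l * j))"
    using l by (subst sum.reindex) (auto simp: inj_on_def fps_nth_compose_X_power[OF l])
  also have "\<dots> = (\<Sum>j\<in>?K. ?D $ j * fps_nth_int (inverse ?D) (z - int (l * j)))"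
  proof (rule sum.cong[OF refl])
    fix j assume "j \<in> ?K"
    then have "z - int (l * j) = int (N - l * j)"
      using z by (simp only: mem_Collect_eq of_nat_diff)
    then show "?D $ j * inverse ?D $ (N - l * j) = ?D $ j * fps_nth_int (inverse ?D) (z - int (l * j))"
      by (simp only: fps_nth_int_def nat_int) simp
  qed
  also have "\<dots> = (\<Sum>j\<in>J. ?D $ j * fps_nth_int (inverse ?D) (z - int (l * j)))"
  proof (rule sum.mono_neutral_left[OF J(1) K], rule ballI)
    fix j assume "j \<in> J - ?K"
    then have "N < l * j" by simp
    then have "z - int (l * j) < 0"
      using z by (simp only: of_nat_less_iff diff_less_0_iff_less)
    then show "?D $ j * fps_nth_int (inverse ?D) (z - int (l * j)) = 0"
      by (simp only: fps_nth_int_def if_True mult_zero_right)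
  qed
  finally show ?thesis .
qed

text \<open>
  Expanding the box counts on the left gives a double sum over \<open>h < k\<close> and \<open>j \<le> m\<close> of terms
  \<open>e\<^sub>h e\<^sub>j p(k (m - j) - (m - j + 1) h)\<close>. The argument of \<open>p\<close> equals
  \<open>(m (k - h) - h) - (k - h) j\<close>, so for fixed \<open>h\<close> the sum over \<open>j\<close> is again the expansion of a
  box count, now with side \<open>k - h\<close>.
\<close>

theorem denominator_times_box_series:
  fixes A :: "'b set"
  assumes A: "finite A" and w: "\<And>i. i \<in> A \<Longrightarrow> 0 < w i" and k: "0 < k"
  shows "(denominator A w * Abs_fps (\<lambda>d. of_nat (card (box_solutions A w (Suc d) (int (k * d)))))) $ m =
    (\<Sum>h<k. denominator A w $ h *
       (of_nat (card (box_solutions A w (k - h) (int m * int (k - h) - int h))) :: 'a :: field))"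
proof -
  let ?D = "denominator A w :: 'a fps"
  let ?p = "fps_nth_int (inverse ?D)"
  (* The range h < k suffices for every d, because (d + 1) h <= k d implies h < k. *)
  have box: "(of_nat (card (box_solutions A w (Suc d) (int (k * d)))) :: 'a) =
      (\<Sum>h<k. ?D $ h * ?p (int (k * d) - int (Suc d * h)))" for d
  proof -
    have "h < k" if "int (Suc d * h) \<le> int (k * d)" for h
    proof (rule ccontr)
      assume "\<not> h < k"
      then have "k * Suc d \<le> h * Suc d"
        by (intro mult_le_mono1) simp
      moreover have "h * Suc d \<le> k * d"
        using that by (simp only: of_nat_le_iff mult.commute)
      ultimately show False
        using k by simp
    qed
    then show ?thesis
      by (intro card_box_solutions_expand[OF A w]) auto
  qed
  have phi: "(of_nat (card (box_solutions A w (k - h) (int m * int (k - h) - int h))) :: 'a) =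
      (\<Sum>j\<le>m. ?D $ j * ?p (int m * int (k - h) - int h - int ((k - h) * j)))" if "h < k" for h
  proof -
    have "j \<le> m" if "int ((k - h) * j) \<le> int m * int (k - h) - int h" for j
    proof -
      have "int ((k - h) * j) \<le> int (m * (k - h))"
        using that unfolding of_nat_mult by linarith
      then have "j * (k - h) \<le> m * (k - h)"
        by (simp only: of_nat_le_iff mult.commute)
      then show ?thesis
        using \<open>h < k\<close> by simp
    qed
    then show ?thesis
      using \<open>h < k\<close> by (intro card_box_solutions_expand[OF A w]) auto
  qed
  have "(?D * Abs_fps (\<lambda>d. of_nat (card (box_solutions A w (Suc d) (int (k * d)))))) $ m =
      (\<Sum>j\<le>m. \<Sum>h<k. ?D $ j * (?D $ h * ?p (int (k * (m - j)) - int (Suc (m - j) * h))))"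
    by (simp only: fps_mult_nth fps_nth_Abs_fps box sum_distrib_left atLeast0AtMost)
  also have "\<dots> = (\<Sum>h<k. \<Sum>j\<le>m. ?D $ j * (?D $ h * ?p (int (k * (m - j)) - int (Suc (m - j) * h))))"
    by (rule sum.swap)
  also have "\<dots> = (\<Sum>h<k. ?D $ h *
      of_nat (card (box_solutions A w (k - h) (int m * int (k - h) - int h))))"
  proof (rule sum.cong[OF refl])
    fix h assume "h \<in> {..<k}"
    then have h: "h < k" by simp
    have "?D $ j * (?D $ h * ?p (int (k * (m - j)) - int (Suc (m - j) * h))) =
        ?D $ h * (?D $ j * ?p (int m * int (k - h) - int h - int ((k - h) * j)))" if j: "j \<le> m" for j
    proof -
      obtain q where m: "m = j + q"
        using le_Suc_ex[OF j] ..
      obtain r where k: "k = h + r"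
        using le_Suc_ex[OF less_imp_le[OF h]] ..
      have "int (k * (m - j)) - int (Suc (m - j) * h) = int m * int (k - h) - int h - int ((k - h) * j)"
        unfolding m k add_diff_cancel_left' of_nat_mult of_nat_add of_nat_Suc
        by (simp add: algebra_simps)
      then show ?thesis
        by (metis mult.left_commute)
    qed
    then show "(\<Sum>j\<le>m. ?D $ j * (?D $ h * ?p (int (k * (m - j)) - int (Suc (m - j) * h)))) =
        ?D $ h * of_nat (card (box_solutions A w (k - h) (int m * int (k - h) - int h)))"
      unfolding phi[OF h] sum_distrib_left by (intro sum.cong) auto
  qed
  finally show ?thesis .
qed

section \<open>The coefficients of the denominator\<close>

lemma fps_nth_mult_one_mod_X_power:
  fixes F G :: "'a :: comm_ring_1 fps"
  assumes "\<And>j. j < k \<Longrightarrow> G $ j = 1 $ j" and "h < k"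
  shows "(F * G) $ h = F $ h"
proof -
  have "(F * G) $ h = (\<Sum>i = 0..h. if i = h then F $ h else 0)"
    unfolding fps_mult_nth using assms by (intro sum.cong) auto
  then show ?thesis
    by simp
qed

lemma fps_nth_one_minus_X_power:
  "((1 - fps_X) ^ \<mu>) $ j = ((-1) ^ j * of_nat (\<mu> choose j) :: 'a :: comm_ring_1)"
proof -
  have "(1 - fps_X) ^ \<mu> = (- fps_X + 1 :: 'a fps) ^ \<mu>"
    by simp
  also have "\<dots> = (\<Sum>i\<le>\<mu>. of_nat (\<mu> choose i) * (- fps_X) ^ i)"
    by (subst binomial_ring) simp
  also have "\<dots> = (\<Sum>i\<le>\<mu>. fps_const ((-1) ^ i * of_nat (\<mu> choose i)) * fps_X ^ i)"
  proof (rule sum.cong[OF refl])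
    fix i
    have "(- fps_X :: 'a fps) ^ i = fps_const ((-1) ^ i) * fps_X ^ i"
      by (subst power_minus) (simp flip: fps_const_power fps_const_neg)
    then show "of_nat (\<mu> choose i) * (- fps_X) ^ i =
        fps_const ((-1) ^ i * of_nat (\<mu> choose i)) * (fps_X :: 'a fps) ^ i"
      by (simp add: fps_of_nat mult.left_commute mult.commute flip: fps_const_mult)
  qed
  finally have "((1 - fps_X) ^ \<mu>) $ j =
      (\<Sum>i\<le>\<mu>. if j = i then (-1) ^ i * of_nat (\<mu> choose i) else (0 :: 'a))"
    by (simp add: fps_sum_nth if_distrib cong: if_cong)
  also have "\<dots> = (-1) ^ j * of_nat (\<mu> choose j)"
    by (cases "j \<le> \<mu>") (auto simp: binomial_eq_0)
  finally show ?thesis .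
qed

text \<open>
  Only weights below \<open>k\<close> influence coefficients below \<open>k\<close>: the factors of larger weight are \<open>1\<close>
  modulo \<open>X\<^sup>k\<close>. Grouping the others by weight gives powers of \<open>1 - X\<^sup>i\<close>, whose coefficients are
  signed binomial coefficients.
\<close>

lemma denominator_nth:
  assumes A: "finite A" and w: "\<And>i. i \<in> A \<Longrightarrow> 0 < w i" and h: "h < k"
  shows "(denominator A w $ h :: 'a :: idom) =
    (\<Sum>I | I \<in> {1..k - 1} \<rightarrow>\<^sub>E UNIV \<and> (\<Sum>i=1..k - 1. I i * i) = h.
       \<Prod>i=1..k - 1. (-1) ^ I i * of_nat (card {a \<in> A. w a = i} choose I i))"
proof -
  let ?\<mu> = "\<lambda>i. card {a \<in> A. w a = i}"
  let ?L = "{a \<in> A. w a < k}" and ?H = "{a \<in> A. \<not> w a < k}"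
  have "denominator ?H w $ j = (1 $ j :: 'a)" if "j < k" for j
  proof -
    have "finite B \<Longrightarrow> B \<subseteq> ?H \<Longrightarrow> denominator B w $ j = (1 $ j :: 'a)" for B
    proof (induction B rule: finite_induct)
      case (insert b B)
      have "(denominator B w * (1 - fps_X ^ w b)) $ j = (denominator B w $ j :: 'a)"
        by (rule fps_nth_mult_one_mod_X_power[OF _ that]) (use insert.prems in auto)
      then show ?case
        using insert by (simp add: denominator_def mult.commute)
    qed (simp add: denominator_def)
    then show ?thesis
      using A by simp
  qed
  then have "(denominator ?L w * denominator ?H w) $ h = (denominator ?L w $ h :: 'a)"
    using h by (rule fps_nth_mult_one_mod_X_power)
  moreover have "denominator A w = (denominator ?L w * denominator ?H w :: 'a fps)"
  proof -
    have "denominator (?L \<union> ?H) w = (denominator ?L w * denominator ?H w :: 'a fps)"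
      unfolding denominator_def using A by (intro prod.union_disjoint) auto
    moreover have "?L \<union> ?H = A" by auto
    ultimately show ?thesis by simp
  qed
  moreover have "denominator ?L w = (\<Prod>i=1..k - 1. (1 - fps_X) ^ ?\<mu> i oo fps_X ^ i :: 'a fps)"
  proof -
    have "w ` ?L \<subseteq> {1..k - 1}"
      using w by (fastforce simp: Suc_le_eq)
    then have "denominator ?L w =
        (\<Prod>i=1..k - 1. \<Prod>a\<in>{a \<in> ?L. w a = i}. 1 - fps_X ^ w a :: 'a fps)"
      unfolding denominator_def using A by (intro prod.group[symmetric]) auto
    also have "\<dots> = (\<Prod>i=1..k - 1. (1 - fps_X) ^ ?\<mu> i oo fps_X ^ i)"
    proof (rule prod.cong[OF refl])
      fix i assume i: "i \<in> {1..k - 1}"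
      then have "{a \<in> ?L. w a = i} = {a \<in> A. w a = i}"
        using h by auto
      then have "(\<Prod>a\<in>{a \<in> ?L. w a = i}. 1 - fps_X ^ w a :: 'a fps) = (1 - fps_X ^ i) ^ ?\<mu> i"
        by simp
      also have "\<dots> = (1 - fps_X) ^ ?\<mu> i oo fps_X ^ i"
        using i by (simp add: fps_compose_sub_distrib flip: fps_compose_power)
      finally show "(\<Prod>a\<in>{a \<in> ?L. w a = i}. 1 - fps_X ^ w a) =
          ((1 - fps_X) ^ ?\<mu> i oo fps_X ^ i :: 'a fps)" .
    qed
    finally show ?thesis .
  qed
  ultimately have "(denominator A w $ h :: 'a) =
      (\<Prod>i=1..k - 1. (1 - fps_X) ^ ?\<mu> i oo fps_X ^ i) $ h"
    by simp
  also have "\<dots> = (\<Sum>I | I \<in> {1..k - 1} \<rightarrow>\<^sub>E UNIV \<and> (\<Sum>i=1..k - 1. I i * i) = h.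
      \<Prod>i=1..k - 1. ((1 - fps_X) ^ ?\<mu> i) $ I i)"
    by (rule fps_nth_prod_compose_X_power) simp_all
  finally show ?thesis
    by (simp only: fps_nth_one_minus_X_power)
qed

text \<open>
  The generating function is a product over the multiset of weights. This is what makes the number
  of elements of \<open>\<Phi>\<^sub>l\<close> independent of the order in which cycle lengths are listed.
\<close>

lemma card_box_solutions_cong:
  assumes A: "finite A" "\<And>i. i \<in> A \<Longrightarrow> 0 < w i" and B: "finite B" "\<And>i. i \<in> B \<Longrightarrow> 0 < v i"
    and eq: "image_mset w (mset_set A) = image_mset v (mset_set B)"
  shows "card (box_solutions A w l z) = card (box_solutions B v l z)"
proof (cases "z < 0")
  case True
  then show ?thesis by (simp add: box_solutions_negative)
next
  case False
  then have z: "z = int (nat z)" by simp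
  define g :: "nat \<Rightarrow> int fps" where "g u = Abs_fps (\<lambda>j. if j < l then 1 else 0) oo fps_X ^ u" for u
  have "(\<Prod>i\<in>A. g (w i)) = prod_mset (image_mset g (image_mset w (mset_set A)))"
    by (simp add: prod_unfold_prod_mset image_mset.compositionality o_def)
  also have "\<dots> = (\<Prod>i\<in>B. g (v i))"
    unfolding eq by (simp add: prod_unfold_prod_mset image_mset.compositionality o_def)
  finally have "int (card (box_solutions A w l (int (nat z)))) = int (card (box_solutions B v l (int (nat z))))"
    by (simp only: card_box_solutions_eq_nth[OF A] card_box_solutions_eq_nth[OF B] g_def of_nat_id)
  then show ?thesis
    using z by simp
qed

section \<open>The equivariant \<open>H\<^sup>*\<close>-series of the hypersimplex\<close>

lemma perm_character_eq_card_box_solutions: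
  assumes "\<sigma> permutes {..<n}"
  shows "perm_character k n d \<sigma> = card (box_solutions (orbit \<sigma> ` {..<n}) card (Suc d) (int (k * d)))"
proof (cases "d = 0")
  case True
  (* The convention that chi_0 is trivial fits: a box of side 1 contains only the zero function. *)
  have "box_solutions (orbit \<sigma> ` {..<n}) card (Suc 0) 0 = {\<lambda>C\<in>orbit \<sigma> ` {..<n}. 0}"
    by (auto simp: box_solutions_def PiE_iff extensional_def fun_eq_iff)
  with True show ?thesis
    by (simp add: perm_character_def)
qed (simp add: perm_character_def card_fixed_lattice_points[OF assms])

lemma card_Phi:
  assumes \<sigma>: "\<sigma> permutes {..<n}"
  shows "card (Phi n l \<sigma> z) = card (box_solutions (orbit \<sigma> ` {..<n}) card l z)"
proof -
  let ?O = "orbit \<sigma> ` {..<n}"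
  define s where "s = sorted_list_of_multiset (cycle_type n \<sigma>)"
  have mset_s: "mset s = image_mset card (mset_set ?O)"
    unfolding s_def cycle_type_def by (rule mset_sorted_list_of_multiset)
  (* The positions in the sorted list start at 1, hence the shift by one. *)
  have "s = map (\<lambda>i. s ! (i - 1)) [1..<Suc (length s)]"
    by (rule nth_equalityI) (simp_all del: upt_Suc)
  then have "mset s = image_mset (\<lambda>i. s ! (i - 1)) (mset [1..<Suc (length s)])"
    by (metis mset_map)
  also have "mset [1..<Suc (length s)] = mset_set {1..length s}"
    by (simp only: mset_upt atLeastLessThanSuc_atLeastAtMost)
  finally have "image_mset (\<lambda>i. s ! (i - 1)) (mset_set {1..length s}) = image_mset card (mset_set ?O)"
    using mset_s by simp
  moreover have pos: "0 < card C" if "C \<in> ?O" for C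
    using that card_orbit_pos[OF \<sigma> finite_lessThan] by blast
  moreover have "0 < s ! (i - 1)" if "i \<in> {1..length s}" for i
  proof -
    have "s ! (i - 1) \<in># mset s"
      using that by (auto intro: nth_mem)
    then show ?thesis
      unfolding mset_s using pos by auto
  qed
  ultimately have "card (box_solutions {1..length s} (\<lambda>i. s ! (i - 1)) l z) = card (box_solutions ?O card l z)"
    by (intro card_box_solutions_cong) simp_all
  then show ?thesis
    by (simp only: Phi_def Let_def s_def box_solutions_def)
qed

lemma num_cycles_eq_card: "num_cycles n \<sigma> i = card {C \<in> orbit \<sigma> ` {..<n}. card C = i}"
proof -
  have "card -` {i} \<inter> orbit \<sigma> ` {..<n} = {C \<in> orbit \<sigma> ` {..<n}. card C = i}"
    by blast
  then show ?thesis
    by (simp add: num_cycles_def cycle_type_def count_image_mset)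
qed

lemma sum_index_tuples_eq_denominator_nth:
  assumes \<sigma>: "\<sigma> permutes {..<n}" and h: "h < k"
  shows "(\<Sum>I\<in>index_tuples k h.
      (-1) ^ (\<Sum>i=1..k - 1. I i) * of_nat (\<Prod>i=1..k - 1. num_cycles n \<sigma> i choose I i)) =
    (denominator (orbit \<sigma> ` {..<n}) card $ h :: 'a :: idom)"
proof -
  have "(denominator (orbit \<sigma> ` {..<n}) card $ h :: 'a) =
      (\<Sum>I | I \<in> {1..k - 1} \<rightarrow>\<^sub>E UNIV \<and> (\<Sum>i=1..k - 1. I i * i) = h.
         \<Prod>i=1..k - 1. (-1) ^ I i * of_nat (num_cycles n \<sigma> i choose I i))"
    unfolding num_cycles_eq_card
    by (rule denominator_nth[OF _ _ h]) (use card_orbit_pos[OF \<sigma> finite_lessThan] in auto)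
  also have "\<dots> = (\<Sum>I\<in>index_tuples k h.
      (-1) ^ (\<Sum>i=1..k - 1. I i) * of_nat (\<Prod>i=1..k - 1. num_cycles n \<sigma> i choose I i))"
    by (simp only: index_tuples_def mult.commute[of _ "_ :: nat"] prod.distrib power_sum of_nat_prod)
  finally show ?thesis ..
qed

theorem theorem3p3:
  fixes k n m :: nat
    and \<sigma> :: "nat \<Rightarrow> nat"
    and H :: "nat \<Rightarrow> (nat \<Rightarrow> nat) \<Rightarrow> complex"
  assumes "0 < k" and "k < n"
    and "\<sigma> permutes {..<n}"
    and "equivariant_Hstar_series k n H"
  shows "H m \<sigma> =
    (\<Sum>h=0..k - 1.
       (\<Sum>I\<in>index_tuples k h.
          (-1) ^ (\<Sum>i=1..k - 1. I i) * of_nat (\<Prod>i=1..k - 1. num_cycles n \<sigma> i choose I i)) *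
       of_nat (card (Phi n (k - h) \<sigma> (int m * int (k - h) - int h))))"
proof -
  let ?O = "orbit \<sigma> ` {..<n}"
  let ?D = "denominator ?O card :: complex fps"
  let ?chi = "Abs_fps (\<lambda>d. of_nat (card (box_solutions ?O card (Suc d) (int (k * d))))) :: complex fps"
  have pos: "0 < card C" if "C \<in> ?O" for C
    using that card_orbit_pos[OF assms(3) finite_lessThan] by blast
  have "det (1\<^sub>m n - fps_X \<cdot>\<^sub>m perm_mat n \<sigma>) = ?D"
    by (simp only: det_one_minus_perm_mat[OF assms(3)] denominator_def)
  then have "?chi = Abs_fps (\<lambda>m. H m \<sigma>) / ?D"
    using assms(3,4)
    by (simp add: equivariant_Hstar_series_def perm_character_eq_card_box_solutions)
  moreover have D0: "?D $ 0 \<noteq> 0"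
    by (simp add: denominator_nth_0 pos)
  ultimately have "?D * ?chi = Abs_fps (\<lambda>m. H m \<sigma>) * (inverse ?D * ?D)"
    by (simp only: fps_divide_unit[OF D0] mult.commute mult.left_commute)
  then have "H m \<sigma> = (?D * ?chi) $ m"
    by (simp add: inverse_mult_eq_1[OF D0])
  also have "\<dots> = (\<Sum>h<k. ?D $ h *
      of_nat (card (box_solutions ?O card (k - h) (int m * int (k - h) - int h))))"
    by (rule denominator_times_box_series) (use pos assms(1) in auto)
  also have "{..<k} = {0..k - 1}"
    using assms(1) by auto
  also have "(\<Sum>h=0..k - 1. ?D $ h *
      of_nat (card (box_solutions ?O card (k - h) (int m * int (k - h) - int h)))) =
    (\<Sum>h=0..k - 1. (\<Sum>I\<in>index_tuples k h.
       (-1) ^ (\<Sum>i=1..k - 1. I i) * of_nat (\<Prod>i=1..k - 1. num_cycles n \<sigma> i choose I i)) *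
       of_nat (card (Phi n (k - h) \<sigma> (int m * int (k - h) - int h))))"
  proof (rule sum.cong[OF refl])
    fix h assume "h \<in> {0..k - 1}"
    then have h: "h < k" using assms(1) by auto
    show "?D $ h * of_nat (card (box_solutions ?O card (k - h) (int m * int (k - h) - int h))) =
      (\<Sum>I\<in>index_tuples k h.
       (-1) ^ (\<Sum>i=1..k - 1. I i) * of_nat (\<Prod>i=1..k - 1. num_cycles n \<sigma> i choose I i)) *
       of_nat (card (Phi n (k - h) \<sigma> (int m * int (k - h) - int h)))"
      by (simp only: sum_index_tuples_eq_denominator_nth[OF assms(3) h] card_Phi[OF assms(3)])
  qed
  finally show ?thesis .
qed

end
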